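(* Let $d=2m+1$ be an odd positive integer, let $\lambda_k=\cos(k\pi/d)$, and let $T_d$ be the Chebyshev polynomial of degree $d$. Then the polynomial $F_d^+(x,y)=T_d(x)+T_d(y)$ splits, up to a nonzero constant factor, as a product of the linear factor $x+y$ and the quadratic factors $$g^+_k(x,y)= x^2+2\lambda_{2k}xy+y^2-(1-\lambda_{2k}^2),\qquad k=1,\dots,m.$$ In particular, the polynomials $F_d^+(x,y)$ and $F_d^-(x,y)=T_d(x)-T_d(y)$ are affinely equivalent.
   Context: The Chebyshev polynomial $T_d(x)$ is the polynomial of degree $d$ determined by $T_d(x)=\cos(d\arccos x)$. Two polynomials in $\mathbb{C}[x,y]$ are affinely equivalent if one is obtained from the other by composition with an invertible affine transformation of the plane with coordinates $x,y$. *)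

theory Defs
  imports "HOL-Analysis.Analysis" "HOL-Computational_Algebra.Polynomial"
begin

definition chebyshev :: "nat \<Rightarrow> real poly" where
  "chebyshev d =
     (THE p. degree p = d \<and> (\<forall>x\<in>{-1..1}. poly p x = cos (real d * arccos x)))"

lemma chebyshev_ex:
  "\<exists>p :: real poly. degree p = d \<and> (\<forall>t. poly p (cos t) = cos (real d * t))"
proof -
  have "\<exists>p q :: real poly. degree p = d \<and> degree q = Suc d \<and>
          (\<forall>t. poly p (cos t) = cos (real d * t) \<and> poly q (cos t) = cos (real (Suc d) * t))"
  proof (induction d)
    case 0
    show ?case by (rule exI[of _ 1], rule exI[of _ "[:0, 1:]"]) simp
  next
    case (Suc d)
    then obtain p q :: "real poly" where pq: "degree p = d" "degree q = Suc d"
      "\<And>t. poly p (cos t) = cos (real d * t)" "\<And>t. poly q (cos t) = cos (real (Suc d) * t)"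
      by blast
    have "q \<noteq> 0" using pq(2) by auto
    then have "degree ([:0, 2:] * q) = Suc (Suc d)"
      using pq(2) by (simp add: degree_mult_eq)
    then have "degree ([:0, 2:] * q - p) = Suc (Suc d)"
      using pq(1) degree_add_eq_left[of "- p" "[:0, 2:] * q"] by simp
    moreover have "poly ([:0, 2:] * q - p) (cos t) = cos (real (Suc (Suc d)) * t)" for t
    proof -
      have "cos (real (Suc d) * t + t) + cos (real (Suc d) * t - t) = 2 * cos t * cos (real (Suc d) * t)"
        by (simp add: cos_add cos_diff)
      moreover have "real (Suc d) * t + t = real (Suc (Suc d)) * t" "real (Suc d) * t - t = real d * t"
        by (simp_all add: algebra_simps)
      ultimately have "cos (real (Suc (Suc d)) * t) + cos (real d * t) = 2 * cos t * cos (real (Suc d) * t)"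
        by simp
      then show ?thesis using pq(3)[of t] pq(4)[of t] by simp
    qed
    ultimately show ?case using pq(2,4) by blast
  qed
  then show ?thesis by blast
qed

lemma chebyshev_unique:
  fixes p q :: "real poly"
  assumes "\<forall>x\<in>{-1..1}. poly p x = poly q x"
  shows "p = q"
proof (rule ccontr)
  assume "p \<noteq> q"
  then have "finite {x. poly (p - q) x = 0}" by (intro poly_roots_finite) simp
  moreover have "{-1..1} \<subseteq> {x. poly (p - q) x = 0}" using assms by auto
  ultimately have "finite {-1..1 :: real}" by (rule rev_finite_subset)
  then show False using infinite_Icc[of "-1" "1 :: real"] by simp
qed

lemma chebyshev_props:
  "degree (chebyshev d) = d \<and> (\<forall>x\<in>{-1..1}. poly (chebyshev d) x = cos (real d * arccos x))"
  unfolding chebyshev_def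
proof (rule theI')
  obtain p :: "real poly" where p: "degree p = d" "\<And>t. poly p (cos t) = cos (real d * t)"
    using chebyshev_ex[of d] by blast
  have "poly p x = cos (real d * arccos x)" if "x \<in> {-1..1}" for x
    using p(2)[of "arccos x"] that by (simp add: cos_arccos)
  then show "\<exists>!p :: real poly. degree p = d \<and>
      (\<forall>x\<in>{-1..1}. poly p x = cos (real d * arccos x))"
    using p(1) chebyshev_unique by (intro ex1I[of _ p]) auto
qed

text \<open>The ring of complex polynomials in two variables x, y is represented by
  \<^typ>\<open>complex poly poly\<close>: the inner variable is x, the outer variable is y.\<close>

type_synonym bipoly = "complex poly poly"

definition const2 :: "complex \<Rightarrow> bipoly" where "const2 c = [:[:c:]:]"

definition var_x :: bipoly where "var_x = [:[:0, 1:]:]"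

definition var_y :: bipoly where "var_y = [:0, 1:]"

definition subst1 :: "complex poly \<Rightarrow> bipoly \<Rightarrow> bipoly" where
  "subst1 p A = poly (map_poly const2 p) A"

text \<open>\<open>subst2 P A B\<close> is the polynomial P(A(x,y), B(x,y)).\<close>

definition subst2 :: "bipoly \<Rightarrow> bipoly \<Rightarrow> bipoly \<Rightarrow> bipoly" where
  "subst2 P A B = poly (map_poly (\<lambda>p. subst1 p A) P) B"

definition eval2 :: "bipoly \<Rightarrow> complex \<Rightarrow> complex \<Rightarrow> complex" where
  "eval2 P x y = poly (poly P [:y:]) x"

lemma eval2_vars: "eval2 (const2 c) x y = c" "eval2 var_x x y = x" "eval2 var_y x y = y"
  by (simp_all add: eval2_def const2_def var_x_def var_y_def)

lemma subst1_pCons: "subst1 (pCons a p) A = const2 a + A * subst1 p A"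
  by (simp add: subst1_def map_poly_pCons const2_def)

lemma eval2_subst1: "eval2 (subst1 p A) x y = poly p (eval2 A x y)"
  by (induction p) (simp_all add: subst1_pCons, simp_all add: subst1_def eval2_def const2_def)

lemma eval2_subst2: "eval2 (subst2 P A B) x y = eval2 P (eval2 A x y) (eval2 B x y)"
proof (induction P)
  case 0
  show ?case by (simp add: subst2_def eval2_def)
next
  case (pCons p P)
  have "subst2 (pCons p P) A B = subst1 p A + B * subst2 P A B"
    by (simp add: subst2_def map_poly_pCons subst1_def)
  then show ?case
    using pCons.IH eval2_subst1[of p A x y] by (simp add: eval2_def)
qed

text \<open>The invertible affine transformation is \<open>w \<mapsto> M w + v\<close> of the complex plane.\<close>

definition affinely_equivalent :: "bipoly \<Rightarrow> bipoly \<Rightarrow> bool" where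
  "affinely_equivalent P Q \<longleftrightarrow>
     (\<exists>(M :: complex^2^2) (v :: complex^2). invertible M \<and>
        Q = subst2 P
              (const2 (M $ 1 $ 1) * var_x + const2 (M $ 1 $ 2) * var_y + const2 (v $ 1))
              (const2 (M $ 2 $ 1) * var_x + const2 (M $ 2 $ 2) * var_y + const2 (v $ 2)))"

definition cheb_at :: "nat \<Rightarrow> bipoly \<Rightarrow> bipoly" where
  "cheb_at d A = subst1 (map_poly complex_of_real (chebyshev d)) A"

definition F_plus :: "nat \<Rightarrow> bipoly" where
  "F_plus d = cheb_at d var_x + cheb_at d var_y"

definition F_minus :: "nat \<Rightarrow> bipoly" where
  "F_minus d = cheb_at d var_x - cheb_at d var_y"

definition lam :: "nat \<Rightarrow> nat \<Rightarrow> real" where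
  "lam d k = cos (real k * pi / real d)"

definition g_plus :: "nat \<Rightarrow> nat \<Rightarrow> bipoly" where
  "g_plus d k =
     var_x ^ 2 + const2 (complex_of_real (2 * lam d (2 * k))) * var_x * var_y + var_y ^ 2
       - const2 (complex_of_real (1 - (lam d (2 * k)) ^ 2))"

end

theory Submission imports Defs begin

text \<open>Fix \<open>x = cos a\<close> with \<open>0 < a < \<pi>/d\<close>. As a polynomial in \<open>y\<close>, \<open>T\<^sub>d(y) + cos (d a)\<close> vanishes
  at the \<open>d\<close> distinct points \<open>- cos (a + 2 \<pi> j / d)\<close>, \<open>-m \<le> j \<le> m\<close>. The root \<open>j = 0\<close> gives the
  linear factor, and the roots \<open>\<plusminus>k\<close> together give \<open>g\<^sub>k\<close>. Infinitely many values of \<open>x\<close>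
  arise in this way, so the factorization is an identity of polynomials in two variables.\<close>

section \<open>Cosine identity and parity of the Chebyshev polynomials\<close>

text \<open>The definition speaks only of angles \<open>arccos x\<close> in [0, pi]. The polynomial
  from \<open>chebyshev_ex\<close> satisfies the identity at every angle and agrees with
  \<open>chebyshev d\<close> on [-1, 1], hence equals it.\<close>

lemma poly_chebyshev_cos: "poly (chebyshev d) (cos t) = cos (real d * t)"
proof -
  obtain p :: "real poly" where p: "\<And>t. poly p (cos t) = cos (real d * t)"
    using chebyshev_ex[of d] by blast
  have "poly (chebyshev d) x = poly p x" if "x \<in> {-1..1}" for x
    using that chebyshev_props[of d] p[of "arccos x"] by simp
  then have "chebyshev d = p"
    by (intro chebyshev_unique) auto
  then show ?thesis
    by (simp add: p)
qed

text \<open>On [-1, 1], replacing \<open>x = cos t\<close> by \<open>- x\<close> replaces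
  \<open>t\<close> by \<open>pi - t\<close>, and \<open>cos (d * pi) = -1\<close> for odd
  \<open>d\<close>. Uniqueness turns this into an identity of polynomials, valid for every real
  \<open>x\<close>.\<close>

lemma poly_chebyshev_minus:
  assumes "odd d"
  shows "poly (chebyshev d) (- x) = - poly (chebyshev d) x"
proof -
  have "pcompose (chebyshev d) [:0, -1:] = - chebyshev d"
  proof (rule chebyshev_unique, rule ballI)
    fix x :: real
    assume x: "x \<in> {-1..1}"
    define t where "t = arccos x"
    have xt: "x = cos t" "- x = cos (pi - t)"
      using x by (auto simp: t_def)
    have "cos (real d * (pi - t)) = cos (real d * pi) * cos (real d * t)"
      by (simp add: right_diff_distrib cos_diff)
    also have "\<dots> = - cos (real d * t)"
      using assms by (simp add: cos_npi)
    finally have "poly (chebyshev d) (- x) = - poly (chebyshev d) x"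
      unfolding xt(2) unfolding xt(1) poly_chebyshev_cos .
    then show "poly (pcompose (chebyshev d) [:0, -1:]) x = poly (- chebyshev d) x"
      by (simp add: poly_pcompose)
  qed
  then have "poly (pcompose (chebyshev d) [:0, -1:]) x = poly (- chebyshev d) x"
    by simp
  then show ?thesis
    by (simp add: poly_pcompose)
qed

section \<open>Evaluation of bivariate polynomials\<close>

lemma poly_map_poly_of_real:
  "poly (map_poly of_real p) (of_real x :: 'a :: {comm_ring_1, real_algebra_1}) = of_real (poly p x)"
  by (induction p) (simp_all add: map_poly_pCons)

lemma eval2_cheb_at:
  assumes "eval2 A x y = of_real t"
  shows "eval2 (cheb_at d A) x y = of_real (poly (chebyshev d) t)"
  by (simp add: cheb_at_def eval2_subst1 assms poly_map_poly_of_real)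

lemma eval2_simps [simp]:
  "eval2 (P + Q) x y = eval2 P x y + eval2 Q x y"
  "eval2 (P - Q) x y = eval2 P x y - eval2 Q x y"
  "eval2 (P * Q) x y = eval2 P x y * eval2 Q x y"
  "eval2 (P ^ n) x y = eval2 P x y ^ n"
  "eval2 (prod f A) x y = (\<Prod>i\<in>A. eval2 (f i) x y)"
  by (simp_all add: eval2_def poly_prod)

declare eval2_vars [simp]

text \<open>For fixed \<open>y\<close>, the polynomial \<open>P - Q\<close> has infinitely many
  roots in \<open>x\<close>, so it vanishes at the outer argument \<open>[:y:]\<close>. These are
  infinitely many roots of a polynomial over the integral domain of polynomials in \<open>x\<close>,
  which forces \<open>P = Q\<close>.\<close>

lemma eval2_eqI:
  assumes "infinite X" "infinite Y"
    and eq: "\<And>x y. x \<in> X \<Longrightarrow> y \<in> Y \<Longrightarrow> eval2 P x y = eval2 Q x y"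
  shows "P = Q"
proof (rule ccontr)
  assume "P \<noteq> Q"
  then have fin: "finite {q. poly (P - Q) q = 0}"
    by (intro poly_roots_finite) simp
  have "poly (P - Q) [:y:] = 0" if "y \<in> Y" for y
  proof (rule ccontr)
    assume "poly (P - Q) [:y:] \<noteq> 0"
    then have "finite {x. poly (poly (P - Q) [:y:]) x = 0}"
      by (rule poly_roots_finite)
    moreover have "X \<subseteq> {x. poly (poly (P - Q) [:y:]) x = 0}"
      using eq that by (auto simp: eval2_def)
    ultimately show False
      using \<open>infinite X\<close> finite_subset by blast
  qed
  then have "(\<lambda>y. [:y:]) ` Y \<subseteq> {q. poly (P - Q) q = 0}"
    by auto
  then have "finite ((\<lambda>y. [:y:]) ` Y)"
    using fin finite_subset by blast
  moreover have "inj_on (\<lambda>y. [:y:]) Y"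
    by (auto intro: inj_onI)
  ultimately show False
    using \<open>infinite Y\<close> finite_imageD by blast
qed

section \<open>Roots in \<open>y\<close> for fixed \<open>x = cos a\<close>\<close>

text \<open>All angles lie in [-pi, pi], where equal cosines mean equal angles up to sign. Opposite
  angles would make \<open>d * a\<close> an integer multiple of \<open>pi\<close>, although it lies
  strictly between 0 and \<open>pi\<close>.\<close>

lemma inj_on_cos_translates:
  fixes a :: real
  assumes d: "d = 2 * m + 1" and a: "0 < a" "a < pi / real d"
  shows "inj_on (\<lambda>j. cos (a + 2 * of_int j * pi / real d)) {- int m..int m}"
proof (rule inj_onI)
  fix i j
  assume ij: "i \<in> {- int m..int m}" "j \<in> {- int m..int m}"
    and eq: "cos (a + 2 * of_int i * pi / real d) = cos (a + 2 * of_int j * pi / real d)"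
  define f where "f = (\<lambda>j::int. a + 2 * of_int j * pi / real d)"
  have d0: "real d > 0" using d by simp
  have bound: "\<bar>f k\<bar> \<le> pi" if "k \<in> {- int m..int m}" for k
  proof -
    have da: "real d * a < pi" "0 < real d * a"
      using a d0 by (simp_all add: field_simps)
    have fk: "real d * f k = real d * a + 2 * (of_int k * pi)"
      using d0 by (simp add: f_def field_simps)
    have k: "- real m \<le> of_int k" "of_int k \<le> real m"
      using that by auto
    have kpi: "of_int k * pi \<le> real m * pi" "- real m * pi \<le> of_int k * pi"
      using k by (intro mult_right_mono; simp)+
    have "real d * pi = pi + 2 * (real m * pi)"
      by (simp add: d algebra_simps)
    then have "\<bar>real d * f k\<bar> \<le> real d * pi"
      using da kpi unfolding fk abs_le_iff by linarith
    then show ?thesis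
      using d0 by (simp add: abs_mult)
  qed
  have "cos \<bar>f i\<bar> = cos \<bar>f j\<bar>"
    using eq by (simp only: f_def cos_abs_real)
  then have "\<bar>f i\<bar> = \<bar>f j\<bar>"
    by (rule cos_inj_pi[OF abs_ge_zero bound[OF ij(1)] abs_ge_zero bound[OF ij(2)]])
  then consider "f i = f j" | "f i = - f j"
    by linarith
  then show "i = j"
  proof cases
    case 1
    then show ?thesis
      using d0 by (simp add: f_def)
  next
    case 2
    have "real d * (f i + f j) = 2 * (real d * a + of_int (i + j) * pi)"
      using d0 by (simp add: f_def field_simps)
    with 2 have "real d * a = of_int (- (i + j)) * pi"
      by (simp add: algebra_simps)
    moreover have "0 < real d * a" "real d * a < 1 * pi"
      using a d0 by (simp_all add: field_simps)
    \<comment> \<open>No integer lies strictly between 0 and 1, so this case is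
      contradictory.\<close>
    ultimately have "0 < real_of_int (- (i + j))" "real_of_int (- (i + j)) < 1"
      by (simp_all only: zero_less_mult_iff mult_less_cancel_right_pos pi_gt_zero) auto
    then have "0 < - (i + j)" "- (i + j) < 1"
      by (simp_all only: of_int_0_less_iff of_int_less_1_iff)
    then show ?thesis
      by linarith
  qed
qed

text \<open>For \<open>x = cos a\<close> and \<open>b = 2 * k * pi / d\<close>, the right-hand side
  is the value of \<open>g_plus d k\<close> at \<open>(x, y)\<close>, so its roots in
  \<open>y\<close> are \<open>- cos (a + b)\<close> and \<open>- cos (a - b)\<close>.\<close>

lemma add_cos_mult_add_cos:
  fixes a b y :: real
  shows "(y + cos (a + b)) * (y + cos (a - b)) =
    y\<^sup>2 + 2 * cos b * cos a * y + ((cos a)\<^sup>2 - (1 - (cos b)\<^sup>2))"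
proof -
  have "(y + cos (a + b)) * (y + cos (a - b)) =
      y\<^sup>2 + 2 * cos b * cos a * y + ((cos a)\<^sup>2 * (cos b)\<^sup>2 - (sin a)\<^sup>2 * (sin b)\<^sup>2)"
    by (simp add: cos_add cos_diff power2_eq_square algebra_simps)
  also have "(cos a)\<^sup>2 * (cos b)\<^sup>2 - (sin a)\<^sup>2 * (sin b)\<^sup>2 = (cos a)\<^sup>2 - (1 - (cos b)\<^sup>2)"
    by (simp add: sin_squared_eq algebra_simps)
  finally show ?thesis .
qed

text \<open>Both sides have degree at most \<open>d\<close> and the same coefficient at
  \<open>d\<close>, so their difference has degree below \<open>d\<close>; it suffices that both
  vanish on the \<open>d\<close> points of \<open>A\<close>.\<close>

lemma chebyshev_plus_cos_factorization:
  fixes a :: real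
  assumes d: "d = 2 * m + 1" and a: "0 < a" "a < pi / real d"
  shows "chebyshev d + [:cos (real d * a):] = smult (lead_coeff (chebyshev d))
    ([:cos a, 1:] * (\<Prod>k=1..m. [:(cos a)\<^sup>2 - (1 - (lam d (2 * k))\<^sup>2), 2 * lam d (2 * k) * cos a, 1:]))"
    (is "?L = smult ?c ?R")
proof -
  define g where
    "g k = [:(cos a)\<^sup>2 - (1 - (lam d (2 * k))\<^sup>2), 2 * lam d (2 * k) * cos a, 1:]" for k
  define A where "A = (\<lambda>j. - cos (a + 2 * of_int j * pi / real d)) ` {- int m..int m}"
  have "inj_on (\<lambda>j. - cos (a + 2 * of_int j * pi / real d)) {- int m..int m}"
    using inj_on_cos_translates[OF assms] by (simp add: inj_on_def)
  then have card: "card A = d"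
    using d by (simp add: A_def card_image)
  have R: "?R = [:cos a, 1:] * (\<Prod>k=1..m. g k)"
    by (simp add: g_def)
  have g0: "g k \<noteq> 0" and deg_g: "degree (g k) = 2" and lead_g: "lead_coeff (g k) = 1" for k
    by (simp_all add: g_def)
  have deg_R: "degree ?R = d"
    unfolding R using g0 by (subst degree_mult_eq) (auto simp: degree_prod_eq_sum_degree deg_g d)
  have "lead_coeff ?R = 1"
    unfolding R lead_coeff_mult lead_coeff_prod by (simp add: lead_g)
  then have coeff_R: "coeff ?R d = 1"
    by (simp only: deg_R)
  have deg_T: "degree (chebyshev d) = d"
    using chebyshev_props by blast
  have d0: "d > 0" using d by simp
  show ?thesis
  proof (rule poly_eqI_degree_lead_coeff[where n = d and A = A])
    show "coeff ?L d = coeff (smult ?c ?R) d"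
      unfolding coeff_smult coeff_R using d0 by (simp add: deg_T coeff_pCons split: nat.split)
    show "d \<le> card A" by (simp add: card)
    show "degree ?L \<le> d"
      by (rule degree_add_le) (simp_all add: deg_T)
    show "degree (smult ?c ?R) \<le> d"
      by (rule order.trans[OF degree_smult_le]) (simp only: deg_R)
  next
    fix z
    assume "z \<in> A"
    then obtain j where j: "j \<in> {- int m..int m}" "z = - cos (a + 2 * of_int j * pi / real d)"
      by (auto simp: A_def)
    have odd: "odd d" using d by simp
    \<comment> \<open>The shift by \<open>2 * j * pi / d\<close> becomes a full period after
      multiplication by \<open>d\<close>; oddness then gives the value \<open>- cos (d * a)\<close>
      at \<open>z\<close>, cancelling the added constant.\<close>
    have "real d * (a + 2 * of_int j * pi / real d) = real d * a + 2 * pi * of_int j"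
      using d0 by (simp add: field_simps)
    then have "cos (real d * (a + 2 * of_int j * pi / real d)) = cos (real d * a)"
      by (simp only: cos_add cos_int_2pin sin_int_2pin)
    then have L0: "poly ?L z = 0"
      by (simp add: j(2) poly_chebyshev_minus[OF odd] poly_chebyshev_cos)
    have "poly ?R z = 0"
    proof (cases "j = 0")
      case True
      then show ?thesis
        unfolding R by (simp add: j(2))
    next
      case False
      \<comment> \<open>The size of \<open>j\<close> selects the quadratic factor, its sign selects
        one of the two roots of that factor.\<close>
      define k where "k = nat \<bar>j\<bar>"
      define b where "b = real (2 * k) * pi / real d"
      have k: "k \<in> {1..m}"
        using j(1) False by (auto simp: k_def)
      have "z = - cos (a + b) \<or> z = - cos (a - b)"
        by (cases "j \<ge> 0") (simp_all add: j(2) b_def k_def)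
      then have "(z + cos (a + b)) * (z + cos (a - b)) = 0"
        by auto
      then have "poly (g k) z = 0"
        unfolding add_cos_mult_add_cos
        by (simp add: g_def lam_def b_def power2_eq_square algebra_simps)
      then have "poly (\<Prod>k=1..m. g k) z = 0"
        using k by (auto simp: poly_prod)
      then show ?thesis
        unfolding R by simp
    qed
    then show "poly ?L z = poly (smult ?c ?R) z"
      using L0 by simp
  qed
qed

section \<open>Factorization and affine equivalence\<close>

lemma F_plus_factorization:
  assumes d: "d = 2 * m + 1"
  shows "F_plus d = const2 (of_real (lead_coeff (chebyshev d))) *
    ((var_x + var_y) * (\<Prod>k=1..m. g_plus d k))"
proof (rule eval2_eqI)
  let ?I = "{0<..<pi / real d}"
  \<comment> \<open>The interval of angles lies in [0, pi], where the cosine is injective; so it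
    yields infinitely many values of \<open>x\<close>.\<close>
  have "pi / real d \<le> pi / 1"
    by (rule divide_left_mono) (simp_all add: d)
  then have I: "?I \<subseteq> {0..pi}"
    by auto
  have "inj_on (\<lambda>a. complex_of_real (cos a)) ?I"
  proof (rule inj_onI)
    fix a b
    assume ab: "a \<in> ?I" "b \<in> ?I" and "complex_of_real (cos a) = complex_of_real (cos b)"
    then have "cos a = cos b"
      by (simp only: of_real_eq_iff)
    moreover have "a \<in> {0..pi}" "b \<in> {0..pi}"
      using I ab by blast+
    ultimately show "a = b"
      using cos_inj_pi by simp
  qed
  moreover have "infinite ?I"
    using d by (intro infinite_Ioo) simp
  ultimately show "infinite ((\<lambda>a. complex_of_real (cos a)) ` ?I)"
    using finite_imageD by blast
  show "infinite (range complex_of_real)"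
    using finite_imageD[of complex_of_real UNIV] infinite_UNIV_char_0 by (auto simp: inj_on_def)
next
  fix x y
  assume "x \<in> (\<lambda>a. complex_of_real (cos a)) ` {0<..<pi / real d}" "y \<in> range complex_of_real"
  then obtain a t where a: "0 < a" "a < pi / real d" and xy: "x = of_real (cos a)" "y = of_real t"
    by auto
  let ?c = "lead_coeff (chebyshev d)"
  let ?g = "\<lambda>k. t\<^sup>2 + 2 * lam d (2 * k) * cos a * t + ((cos a)\<^sup>2 - (1 - (lam d (2 * k))\<^sup>2))"
  have "poly (chebyshev d + [:cos (real d * a):]) t = ?c * ((cos a + t) * (\<Prod>k=1..m. ?g k))"
    unfolding chebyshev_plus_cos_factorization[OF assms a]
    by (simp only: poly_smult poly_mult poly_prod poly_pCons poly_0)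
      (simp add: power2_eq_square ring_distribs ac_simps)
  then have eq: "poly (chebyshev d) (cos a) + poly (chebyshev d) t =
      ?c * ((cos a + t) * (\<Prod>k=1..m. ?g k))"
    by (simp add: poly_chebyshev_cos)
  have g: "eval2 (g_plus d k) x y = of_real (?g k)" for k
    by (simp add: g_plus_def xy)
  have "eval2 (F_plus d) x y = of_real (poly (chebyshev d) (cos a) + poly (chebyshev d) t)"
    by (simp add: F_plus_def eval2_cheb_at xy)
  also have "\<dots> = eval2 (const2 (of_real ?c) * ((var_x + var_y) * (\<Prod>k=1..m. g_plus d k))) x y"
    unfolding eq eval2_simps eval2_vars g unfolding xy by simp
  finally show "eval2 (F_plus d) x y =
      eval2 (const2 (of_real ?c) * ((var_x + var_y) * (\<Prod>k=1..m. g_plus d k))) x y" .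
qed

text \<open>Since the Chebyshev polynomial is odd, the reflection of \<open>y\<close> to
  \<open>- y\<close>, with matrix \<open>?M\<close> and no translation, changes the sign of its
  \<open>y\<close> term. Comparing values at real points is enough.\<close>

lemma affinely_equivalent_F_plus_F_minus:
  assumes "odd d"
  shows "affinely_equivalent (F_plus d) (F_minus d)"
proof -
  let ?M = "vector [vector [1, 0], vector [0, -1]] :: complex^2^2"
  have "invertible ?M"
    by (simp add: invertible_det_nz det_2)
  moreover have "F_minus d = subst2 (F_plus d)
      (const2 (?M $ 1 $ 1) * var_x + const2 (?M $ 1 $ 2) * var_y + const2 ((0 :: complex^2) $ 1))
      (const2 (?M $ 2 $ 1) * var_x + const2 (?M $ 2 $ 2) * var_y + const2 ((0 :: complex^2) $ 2))"
  proof (rule eval2_eqI)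
    show "infinite (range complex_of_real)" "infinite (range complex_of_real)"
      using finite_imageD[of complex_of_real UNIV] infinite_UNIV_char_0 by (auto simp: inj_on_def)
  next
    fix x y
    assume "x \<in> range complex_of_real" "y \<in> range complex_of_real"
    then obtain s t where xy: "x = of_real s" "y = of_real t"
      by auto
    have minus: "eval2 (cheb_at d var_y) (of_real s) (- of_real t) = - of_real (poly (chebyshev d) t)"
      using eval2_cheb_at[of var_y "of_real s" "- of_real t" "- t" d]
      by (simp add: poly_chebyshev_minus[OF assms])
    show "eval2 (F_minus d) x y = eval2 (subst2 (F_plus d)
      (const2 (?M $ 1 $ 1) * var_x + const2 (?M $ 1 $ 2) * var_y + const2 ((0 :: complex^2) $ 1))
      (const2 (?M $ 2 $ 1) * var_x + const2 (?M $ 2 $ 2) * var_y + const2 ((0 :: complex^2) $ 2))) x y"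
      by (simp add: eval2_subst2 F_minus_def F_plus_def eval2_cheb_at xy minus)
  qed
  ultimately show ?thesis
    unfolding affinely_equivalent_def by blast
qed

theorem corollary2p2:
  fixes d m :: nat
  assumes "d = 2 * m + 1"
  shows "(\<exists>c :: complex. c \<noteq> 0 \<and>
            F_plus d = const2 c * ((var_x + var_y) * (\<Prod>k=1..m. g_plus d k)))
         \<and> affinely_equivalent (F_plus d) (F_minus d)"
proof
  \<comment> \<open>The constant factor is the leading coefficient; positive degree excludes the
    zero polynomial, so it is nonzero.\<close>
  have "degree (chebyshev d) \<noteq> 0"
    using chebyshev_props[of d] assms by simp
  then have "complex_of_real (lead_coeff (chebyshev d)) \<noteq> 0"
    by auto
  then show "\<exists>c :: complex. c \<noteq> 0 \<and>
      F_plus d = const2 c * ((var_x + var_y) * (\<Prod>k=1..m. g_plus d k))"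
    using F_plus_factorization[OF assms] by blast
  show "affinely_equivalent (F_plus d) (F_minus d)"
    using assms by (intro affinely_equivalent_F_plus_F_minus) simp
qed

end
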